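(* Let $\tau:[0,1]\to\mathbb{R}$ be the Takagi function. The graph $\mathcal{G}(\tau) = \{(x,\tau(x)) : 0\le x\le 1\}$ has infinite length locally. That is, it has infinite length over any nonempty open interval $x_1<x<x_2$ in $[0,1]$.
   Context: The Takagi function is $\tau(x) = \sum_{n=0}^{\infty} \frac{1}{2^n}\,\langle\!\langle 2^n x\rangle\!\rangle$, where $\langle\!\langle x\rangle\!\rangle$ denotes the distance from the real number $x$ to the nearest integer. The length of the graph over an interval is the usual length of a curve, i.e. the supremum of the lengths of inscribed polygonal paths with vertices $(t_i,\tau(t_i))$, $t_0<t_1<\cdots<t_N$ in the interval. *)

theory Defs
  imports "HOL-Analysis.Analysis"
begin

(* infdist x \<int> is the distance from x to the nearest integer. *)
definition takagi :: "real \<Rightarrow> real" where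
  "takagi x = (\<Sum>n. 1 / 2 ^ n * infdist (2 ^ n * x) \<int>)"

lemma summable_takagi: "summable (\<lambda>n. 1 / 2 ^ n * infdist (2 ^ n * x) (\<int> :: real set))"
proof (rule summable_comparison_test')
  show "summable (\<lambda>n. (1 / 2 :: real) ^ n)"
    by (simp add: summable_geometric)
  fix n :: nat
  have "infdist (2 ^ n * x) (\<int> :: real set) \<le> dist (2 ^ n * x) (of_int \<lfloor>2 ^ n * x\<rfloor>)"
    by (rule infdist_le) simp
  also have "\<dots> \<le> 1"
    unfolding dist_real_def by linarith
  finally show "norm (1 / 2 ^ n * infdist (2 ^ n * x) (\<int> :: real set)) \<le> (1 / 2) ^ n"
    by (simp add: infdist_nonneg power_one_over divide_simps)
qed

(* The length of the graph of f over S: the supremum of the Euclidean lengths of the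
   polygonal paths with vertices (t i, f (t i)), where t 0 < \<dots> < t N lie in S.
   The metric on real \<times> real is the Euclidean one. *)
definition graph_length :: "(real \<Rightarrow> real) \<Rightarrow> real set \<Rightarrow> ennreal" where
  "graph_length f S =
     (SUP (N, t) \<in> {(N :: nat, t :: nat \<Rightarrow> real). strict_mono_on {..N} t \<and> t ` {..N} \<subseteq> S}.
        ennreal (\<Sum>i<N. dist (t i, f (t i)) (t (Suc i), f (t (Suc i)))))"

end

theory Submission
  imports Defs
begin

text \<open>
  The length of the graph is at least the variation \<open>\<Sum>i. \<bar>\<tau>(t\<^sub>i\<^sub>+\<^sub>1) - \<tau>(t\<^sub>i)\<bar>\<close> over any partition,
  so it is enough to make this variation large on the equal subdivisions of one dyadic interval
  inside the given open interval.

  The reason why it becomes large is that the chord slopes of \<open>\<tau>\<close> perform a simple random walk.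
  By \<open>takagi_midpoint\<close>, halving a dyadic interval over which the chord of \<open>\<tau>\<close> has slope \<open>s\<close> yields
  two chords with slopes \<open>s + 1\<close> and \<open>s - 1\<close>. After \<open>p\<close> halvings, the variation divided by the
  length of the interval is the mean of \<open>\<bar>S\<bar>\<close>, where \<open>S\<close> is the position after \<open>p\<close> steps of a
  simple random walk that starts at \<open>s\<close>. This mean grows like the square root of \<open>p\<close>.

  An elementary way to see the growth is to compare \<open>\<bar>S\<bar>\<close> with a polynomial whose mean is explicit:
  \<open>\<bar>S\<bar> \<ge> c S\<^sup>2 - c\<^sup>3 S\<^sup>4\<close> for every \<open>c \<ge> 0\<close>, and the second and fourth moments of the walk are
  polynomials in \<open>p\<close> and \<open>s\<close>. This is the bound \<open>dyadic_variation_ge\<close>. For fixed \<open>s\<close> the moments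
  are of order \<open>p\<close> and \<open>3 p\<^sup>2\<close>, so that \<open>c\<close> of order \<open>1 / sqrt p\<close> gives a lower bound of
  order \<open>sqrt p\<close>.
\<close>

section \<open>Distance to the nearest integer\<close>

lemma Ints_nonempty: "(\<int> :: real set) \<noteq> {}"
  using Ints_0 by blast

lemma infdist_Ints_lower_half:
  fixes y :: real and m :: int
  assumes "of_int m \<le> y" "y \<le> of_int m + 1 / 2"
  shows "infdist y \<int> = y - of_int m"
proof (rule antisym)
  show "infdist y \<int> \<le> y - of_int m"
    using infdist_le[of "of_int m" \<int> y] assms by (simp add: dist_real_def)
  show "y - of_int m \<le> infdist y \<int>"
    unfolding infdist_notempty[OF Ints_nonempty]
  proof (rule cINF_greatest[OF Ints_nonempty])
    fix z :: real assume "z \<in> \<int>"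
    then obtain k where "z = of_int k" by (elim Ints_cases)
    moreover have "k \<le> m \<or> m + 1 \<le> k" by linarith
    then have "real_of_int k \<le> of_int m \<or> of_int m + 1 \<le> real_of_int k" by linarith
    ultimately show "y - of_int m \<le> dist y z"
      using assms unfolding dist_real_def by linarith
  qed
qed

lemma infdist_Ints_upper_half:
  fixes y :: real and m :: int
  assumes "of_int m + 1 / 2 \<le> y" "y \<le> of_int m + 1"
  shows "infdist y \<int> = of_int m + 1 - y"
proof (rule antisym)
  show "infdist y \<int> \<le> of_int m + 1 - y"
    using infdist_le[of "of_int (m + 1)" \<int> y] assms by (simp add: dist_real_def)
  show "of_int m + 1 - y \<le> infdist y \<int>"
    unfolding infdist_notempty[OF Ints_nonempty]
  proof (rule cINF_greatest[OF Ints_nonempty])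
    fix z :: real assume "z \<in> \<int>"
    then obtain k where "z = of_int k" by (elim Ints_cases)
    moreover have "k \<le> m \<or> m + 1 \<le> k" by linarith
    then have "real_of_int k \<le> of_int m \<or> of_int m + 1 \<le> real_of_int k" by linarith
    ultimately show "of_int m + 1 - y \<le> dist y z"
      using assms unfolding dist_real_def by linarith
  qed
qed

text \<open>
  All breakpoints of the distance function are half-integers, and these are endpoints of the dyadic
  intervals of length at most \<open>1 / 2\<close>. Hence the function is affine on each such interval.
\<close>

lemma infdist_Ints_midpoint:
  fixes x :: real
  assumes "2 ^ Suc n * x \<in> \<int>"
  shows "infdist (x + 1 / 2 ^ Suc (Suc n)) \<int> = (infdist x \<int> + infdist (x + 1 / 2 ^ Suc n) \<int>) / 2"
proof -
  define h where "h = 1 / (2 :: real) ^ Suc n"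
  define q where "q = \<lfloor>2 * x\<rfloor>"
  have h: "h > 0" "2 ^ n * h = 1 / 2" "1 / 2 ^ Suc (Suc n) = h / 2" by (simp_all add: h_def)
  obtain z where z: "2 ^ Suc n * x = of_int z" using assms by (elim Ints_cases)
  have q: "of_int q \<le> 2 * x" "2 * x < of_int q + 1" unfolding q_def by linarith+
  \<comment> \<open>Both \<open>x\<close> and \<open>(q + 1) / 2\<close> are multiples of \<open>h\<close>, so the strict inequality between them leaves
    room for a full step \<open>h\<close>.\<close>
  have "2 ^ n * (2 * x) < 2 ^ n * (of_int q + 1)" using q by simp
  then have "real_of_int z < of_int (2 ^ n * (q + 1))" using z by (simp add: algebra_simps)
  then have "z + 1 \<le> 2 ^ n * (q + 1)" by linarith
  then have "real_of_int (z + 1) \<le> of_int (2 ^ n * (q + 1))" by (simp only: of_int_le_iff)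
  then have "2 ^ n * (2 * (x + h)) \<le> 2 ^ n * (of_int q + 1)" using z h by (simp add: algebra_simps)
  then have qh: "2 * (x + h) \<le> of_int q + 1" by simp
  have "infdist (x + h / 2) \<int> = (infdist x \<int> + infdist (x + h) \<int>) / 2"
  proof (cases "even q")
    case True
    then obtain m where m: "q = 2 * m" by (elim evenE)
    have *: "infdist y \<int> = y - of_int m" if "x \<le> y" "y \<le> x + h" for y
      using that q qh m by (intro infdist_Ints_lower_half) auto
    show ?thesis using h by (simp add: * field_simps)
  next
    case False
    then obtain m where m: "q = 2 * m + 1" by (elim oddE)
    have *: "infdist y \<int> = of_int m + 1 - y" if "x \<le> y" "y \<le> x + h" for y
      using that q qh m by (intro infdist_Ints_upper_half) auto
    show ?thesis using h by (simp add: * field_simps)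
  qed
  then show ?thesis by (simp only: h h_def[symmetric])
qed

section \<open>Chord slopes of the Takagi function\<close>

lemma takagi_functional_equation: "takagi x = infdist x \<int> + takagi (2 * x) / 2"
proof -
  have "takagi x = infdist x \<int> + (\<Sum>n. 1 / 2 ^ Suc n * infdist (2 ^ Suc n * x) \<int>)"
    unfolding takagi_def using suminf_split_head[OF summable_takagi[of x]] by simp
  also have "(\<Sum>n. 1 / 2 ^ Suc n * infdist (2 ^ Suc n * x) \<int>) =
             (\<Sum>n. 1 / 2 ^ n * infdist (2 ^ n * (2 * x)) (\<int> :: real set) / 2)"
    by (simp add: mult_ac)
  also have "\<dots> = takagi (2 * x) / 2"
    unfolding takagi_def by (rule suminf_divide[OF summable_takagi])
  finally show ?thesis .
qed

lemma takagi_Ints: "x \<in> \<int> \<Longrightarrow> takagi x = 0"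
  unfolding takagi_def by simp

text \<open>
  The functional equation transports the midpoint rule from \<open>2 * x\<close> to \<open>x\<close>, because its other
  term is affine on the interval. At an interval of length \<open>1\<close> with integral endpoints the rule
  amounts to \<open>\<tau>(1/2) = 1/2\<close>.
\<close>

lemma takagi_midpoint:
  assumes "2 ^ n * x \<in> \<int>"
  shows "takagi (x + 1 / 2 ^ Suc n) = (takagi x + takagi (x + 1 / 2 ^ n)) / 2 + 1 / 2 ^ Suc n"
  using assms
proof (induction n arbitrary: x)
  case 0
  then have x: "x \<in> \<int>" by simp
  then obtain m where m: "x = of_int m" by (elim Ints_cases)
  have "takagi (x + 1 / 2) = infdist (x + 1 / 2) \<int> + takagi (2 * x + 1) / 2"
    using takagi_functional_equation[of "x + 1 / 2"] by (simp add: algebra_simps)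
  also have "takagi (2 * x + 1) = 0" using x by (intro takagi_Ints) auto
  also have "infdist (x + 1 / 2) \<int> = 1 / 2" by (subst infdist_Ints_lower_half[of m]) (auto simp: m)
  finally show ?case using x by (simp add: takagi_Ints)
next
  case (Suc n)
  have "2 ^ n * (2 * x) \<in> \<int>" using Suc.prems by (simp add: mult.assoc mult.left_commute)
  note IH = Suc.IH[OF this]
  define h where "h = 1 / (2 :: real) ^ Suc n"
  have h: "1 / 2 ^ n = 2 * h" "1 / 2 ^ Suc n = h" "1 / 2 ^ Suc (Suc n) = h / 2"
    by (simp_all add: h_def)
  have "takagi (x + h / 2) = infdist (x + h / 2) \<int> + takagi (2 * x + h) / 2"
    and "takagi (x + h) = infdist (x + h) \<int> + takagi (2 * x + 2 * h) / 2"
    using takagi_functional_equation[of "x + h / 2"] takagi_functional_equation[of "x + h"]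
    by (simp_all add: distrib_left)
  then show ?case
    unfolding h
    using IH[unfolded h] infdist_Ints_midpoint[OF Suc.prems, unfolded h]
      takagi_functional_equation[of x]
    by argo
qed

definition chord_slope :: "(real \<Rightarrow> real) \<Rightarrow> nat \<Rightarrow> real \<Rightarrow> real" where
  "chord_slope f n x = 2 ^ n * (f (x + 1 / 2 ^ n) - f x)"

lemma chord_slope_takagi_left:
  assumes "2 ^ n * x \<in> \<int>"
  shows "chord_slope takagi (Suc n) x = chord_slope takagi n x + 1"
  unfolding chord_slope_def takagi_midpoint[OF assms] by (simp add: field_simps)

lemma chord_slope_takagi_right:
  assumes "2 ^ n * x \<in> \<int>"
  shows "chord_slope takagi (Suc n) (x + 1 / 2 ^ Suc n) = chord_slope takagi n x - 1"
proof -
  have right_end: "x + 1 / 2 ^ Suc n + 1 / 2 ^ Suc n = x + 1 / 2 ^ n" by (simp add: field_simps)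
  show ?thesis
    unfolding chord_slope_def right_end takagi_midpoint[OF assms] by (simp add: field_simps)
qed

section \<open>Growth of the variation under dyadic subdivision\<close>

definition dyadic_variation :: "(real \<Rightarrow> real) \<Rightarrow> nat \<Rightarrow> nat \<Rightarrow> real \<Rightarrow> real" where
  "dyadic_variation f n p x =
     (\<Sum>i<2 ^ p. \<bar>f (x + real (Suc i) / 2 ^ (n + p)) - f (x + real i / 2 ^ (n + p))\<bar>)"

lemma dyadic_variation_0: "dyadic_variation f n 0 x = \<bar>chord_slope f n x\<bar> / 2 ^ n"
  by (simp add: dyadic_variation_def chord_slope_def abs_mult)

lemma sum_lessThan_add:
  fixes g :: "nat \<Rightarrow> 'a::comm_monoid_add"
  shows "(\<Sum>i<m + n. g i) = (\<Sum>i<m. g i) + (\<Sum>i<n. g (m + i))"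
  by (induction n) (simp_all add: add.assoc)

lemma dyadic_variation_Suc:
  "dyadic_variation f n (Suc p) x =
     dyadic_variation f (Suc n) p x + dyadic_variation f (Suc n) p (x + 1 / 2 ^ Suc n)"
proof -
  define g where "g i = \<bar>f (x + real (Suc i) / 2 ^ (n + Suc p)) - f (x + real i / 2 ^ (n + Suc p))\<bar>"
    for i
  have shift: "real (2 ^ p + i) / 2 ^ (n + Suc p) = 1 / 2 ^ Suc n + real i / 2 ^ (Suc n + p)" for i
    by (simp add: power_add add_divide_distrib)
  have "(2 :: nat) ^ Suc p = 2 ^ p + 2 ^ p" by simp
  then have "dyadic_variation f n (Suc p) x = (\<Sum>i<2 ^ p + 2 ^ p. g i)"
    by (simp only: dyadic_variation_def g_def)
  also have "\<dots> = (\<Sum>i<2 ^ p. g i) + (\<Sum>i<2 ^ p. g (2 ^ p + i))"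
    by (rule sum_lessThan_add)
  also have "(\<Sum>i<2 ^ p. g i) = dyadic_variation f (Suc n) p x"
    by (simp only: dyadic_variation_def g_def add_Suc_shift)
  also have "(\<Sum>i<2 ^ p. g (2 ^ p + i)) = dyadic_variation f (Suc n) p (x + 1 / 2 ^ Suc n)"
    by (simp only: dyadic_variation_def g_def add_Suc_right[symmetric] shift add.assoc)
  finally show ?thesis .
qed

text \<open>
  This is the quantitative form of the growth of the mean of \<open>\<bar>S\<bar>\<close>. The factor of \<open>c\<close> is the
  second moment, and the factor of \<open>c\<^sup>3\<close> the fourth moment, of a simple random walk after \<open>p\<close>
  steps from \<open>s\<close>, so the right-hand side obeys the same averaging recursion in \<open>p\<close> as the
  variation. Only \<open>\<bar>s\<bar> \<ge> c s\<^sup>2 - c\<^sup>3 s\<^sup>4\<close> remains to be checked at \<open>p = 0\<close>.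
\<close>

lemma dyadic_variation_ge:
  fixes c :: real
  assumes "c \<ge> 0" "2 ^ n * x \<in> \<int>"
  defines "s \<equiv> chord_slope takagi n x"
  shows "2 ^ n * dyadic_variation takagi n p x \<ge>
           c * (s ^ 2 + p) - c ^ 3 * (s ^ 4 + 6 * p * s ^ 2 + 3 * p ^ 2 - 2 * p)"
  using assms(2) unfolding s_def
proof (induction p arbitrary: n x)
  case 0
  define b where "b = \<bar>chord_slope takagi n x\<bar>"
  define u where "u = c * b"
  have b: "b \<ge> 0" and u: "u \<ge> 0" using assms(1) by (simp_all add: b_def u_def)
  have "u - u ^ 3 \<le> 1"
  proof (cases "u \<le> 1")
    case True
    then show ?thesis using zero_le_power[OF u, of 3] by linarith
  next
    case False
    then show ?thesis using power_increasing[of 1 3 u] by simp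
  qed
  then have "b * (u - u ^ 3) \<le> b * 1" using b by (rule mult_left_mono)
  moreover have "b * (u - u ^ 3) = c * b ^ 2 - c ^ 3 * b ^ 4"
    by (simp add: u_def algebra_simps eval_nat_numeral)
  ultimately have "c * b ^ 2 - c ^ 3 * b ^ 4 \<le> b" by simp
  moreover have "b ^ 2 = chord_slope takagi n x ^ 2" "b ^ 4 = chord_slope takagi n x ^ 4"
    by (simp_all add: b_def power_even_abs)
  ultimately show ?case by (simp add: dyadic_variation_0 flip: b_def)
next
  case (Suc p)
  let ?s = "chord_slope takagi n x"
  have left: "2 ^ Suc n * x \<in> \<int>"
    using Suc.prems by (metis Ints_mult Ints_numeral mult.assoc power_Suc)
  have right: "2 ^ Suc n * (x + 1 / 2 ^ Suc n) \<in> \<int>"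
    using left by (simp add: distrib_left)
  have "2 * (2 ^ n * dyadic_variation takagi n (Suc p) x) =
          2 ^ Suc n * dyadic_variation takagi (Suc n) p x +
          2 ^ Suc n * dyadic_variation takagi (Suc n) p (x + 1 / 2 ^ Suc n)"
    unfolding dyadic_variation_Suc by (simp add: algebra_simps)
  also have "\<dots> \<ge> (c * ((?s + 1) ^ 2 + real p)
                   - c ^ 3 * ((?s + 1) ^ 4 + 6 * real p * (?s + 1) ^ 2 + 3 * real p ^ 2 - 2 * real p))
               + (c * ((?s - 1) ^ 2 + real p)
                   - c ^ 3 * ((?s - 1) ^ 4 + 6 * real p * (?s - 1) ^ 2 + 3 * real p ^ 2 - 2 * real p))"
    using Suc.IH[OF left] Suc.IH[OF right]
    unfolding chord_slope_takagi_left[OF Suc.prems] chord_slope_takagi_right[OF Suc.prems]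
    by (rule add_mono)
  also have "(c * ((?s + 1) ^ 2 + real p)
                   - c ^ 3 * ((?s + 1) ^ 4 + 6 * real p * (?s + 1) ^ 2 + 3 * real p ^ 2 - 2 * real p))
               + (c * ((?s - 1) ^ 2 + real p)
                   - c ^ 3 * ((?s - 1) ^ 4 + 6 * real p * (?s - 1) ^ 2 + 3 * real p ^ 2 - 2 * real p)) =
             2 * (c * (?s ^ 2 + (real p + 1))
               - c ^ 3 * (?s ^ 4 + 6 * (real p + 1) * ?s ^ 2 + 3 * (real p + 1) ^ 2
                          - 2 * (real p + 1)))"
    by (simp add: field_simps eval_nat_numeral)
  finally show ?case by (simp add: add.commute)
qed

text \<open>
  Taking \<open>p\<close> equal to \<open>6 k\<^sup>2\<close> and \<open>c\<close> equal to \<open>1 / (6 k)\<close> makes the terms in \<open>s\<^sup>2\<close> cancel and the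
  leading terms combine to \<open>k - k / 2\<close>.
\<close>

lemma dyadic_variation_unbounded:
  assumes "2 ^ n * x \<in> \<int>"
  shows "\<exists>p. dyadic_variation takagi n p x \<ge> B"
proof -
  define s where "s = chord_slope takagi n x"
  obtain k :: nat where k: "real k \<ge> max 1 (2 * (2 ^ n * B + s ^ 4))"
    using real_arch_simple by blast
  then have k1: "real k \<ge> 1" and k2: "real k \<ge> 2 * (2 ^ n * B + s ^ 4)" by simp_all
  define p where "p = 6 * k ^ 2"
  define c where "c = 1 / (6 * real k)"
  have ck: "c \<ge> 0" "c * k = 1 / 6" using k1 by (simp_all add: c_def)
  have c3: "c ^ 3 * s ^ 4 \<le> s ^ 4"
  proof -
    have "c \<le> 1" using k1 by (simp add: c_def)
    then have "c ^ 3 \<le> 1" using ck(1) by (simp add: power_le_one)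
    then show ?thesis using mult_right_mono[of "c ^ 3" 1 "s ^ 4"] by simp
  qed
  have "2 ^ n * dyadic_variation takagi n p x \<ge> c * (s ^ 2 + real p)
          - c ^ 3 * (s ^ 4 + 6 * real p * s ^ 2 + 3 * real p ^ 2 - 2 * real p)"
    using dyadic_variation_ge[OF ck(1) assms, of p] by (simp flip: s_def)
  also have "c * (s ^ 2 + real p)
          - c ^ 3 * (s ^ 4 + 6 * real p * s ^ 2 + 3 * real p ^ 2 - 2 * real p)
        = c * s ^ 2 * (1 - 36 * (c * k) ^ 2) + 6 * k * (c * k)
          - 108 * k * (c * k) ^ 3 + 12 * c * (c * k) ^ 2 - c ^ 3 * s ^ 4"
    by (simp add: p_def field_simps eval_nat_numeral)
  also have "\<dots> = k / 2 + c / 3 - c ^ 3 * s ^ 4"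
    unfolding ck(2) by (simp add: power2_eq_square power3_eq_cube)
  also have "\<dots> \<ge> 2 ^ n * B" using c3 ck(1) k2 by argo
  finally have "2 ^ n * B \<le> 2 ^ n * dyadic_variation takagi n p x" .
  then have "B \<le> dyadic_variation takagi n p x" by simp
  then show ?thesis ..
qed

section \<open>Length of the graph\<close>

lemma dyadic_variation_le_graph_length:
  assumes "{x..x + 1 / 2 ^ n} \<subseteq> S"
  shows "ennreal (dyadic_variation f n p x) \<le> graph_length f S"
proof -
  define t where "t i = x + real i / 2 ^ (n + p)" for i :: nat
  have "strict_mono_on {..2 ^ p} t"
    by (auto simp: strict_mono_on_def t_def divide_strict_right_mono)
  moreover have "t ` {..2 ^ p} \<subseteq> S"
  proof (intro image_subsetI)
    fix i :: nat assume "i \<in> {..2 ^ p}"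
    then have "real i \<le> real (2 ^ p)" by (simp only: atMost_iff of_nat_le_iff)
    then have "real i / 2 ^ (n + p) \<le> 2 ^ p / 2 ^ (n + p)" by (intro divide_right_mono) simp_all
    then have "t i \<in> {x..x + 1 / 2 ^ n}" by (simp add: t_def power_add)
    then show "t i \<in> S" using assms by blast
  qed
  ultimately have "ennreal (\<Sum>i<2 ^ p. dist (t i, f (t i)) (t (Suc i), f (t (Suc i)))) \<le> graph_length f S"
    unfolding graph_length_def by (intro SUP_upper2[of "(2 ^ p, t)"]) auto
  moreover have "dyadic_variation f n p x \<le> (\<Sum>i<2 ^ p. dist (t i, f (t i)) (t (Suc i), f (t (Suc i))))"
    unfolding dyadic_variation_def
  proof (rule sum_mono)
    fix i
    have "dist (f (t i)) (f (t (Suc i))) \<le> dist (t i, f (t i)) (t (Suc i), f (t (Suc i)))"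
      using dist_snd_le[of "(t i, f (t i))" "(t (Suc i), f (t (Suc i)))"] by simp
    then show "\<bar>f (x + real (Suc i) / 2 ^ (n + p)) - f (x + real i / 2 ^ (n + p))\<bar>
                 \<le> dist (t i, f (t i)) (t (Suc i), f (t (Suc i)))"
      by (simp only: t_def dist_real_def abs_minus_commute)
  qed
  ultimately show ?thesis using ennreal_leI order_trans by blast
qed

lemma dyadic_interval_in_open_interval:
  fixes a b :: real
  assumes "a < b"
  obtains n x where "2 ^ n * x \<in> \<int>" "{x..x + 1 / 2 ^ n} \<subseteq> {a<..<b}"
proof -
  obtain n where n: "(1 / 2) ^ n < (b - a) / 2"
    using real_arch_pow_inv[of "(b - a) / 2" "1 / 2"] assms by auto
  define h where "h = 1 / (2 :: real) ^ n"
  have h: "h > 0" "2 * h < b - a" "2 ^ n * h = 1" using n by (auto simp: h_def power_one_over)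
  \<comment> \<open>The first grid point to the right of \<open>a\<close>; the interval starting there ends at or before \<open>a + 2 h < b\<close>.\<close>
  define x where "x = (of_int \<lfloor>2 ^ n * a\<rfloor> + 1) * h"
  have x: "2 ^ n * x = of_int (\<lfloor>2 ^ n * a\<rfloor> + 1)" using h(3) by (simp add: x_def algebra_simps)
  have "2 ^ n * a < 2 ^ n * x" "2 ^ n * x \<le> 2 ^ n * (a + h)"
    unfolding x distrib_left h(3) by simp_all
  then have "a < x" "x \<le> a + h" by simp_all
  then have "{x..x + h} \<subseteq> {a<..<b}" using h by auto
  moreover have "2 ^ n * x \<in> \<int>" unfolding x by (rule Ints_of_int)
  ultimately show ?thesis using that unfolding h_def by blast
qed

theorem theorem11p4:
  fixes x1 x2 :: real
  assumes "0 \<le> x1" and "x1 < x2" and "x2 \<le> 1"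
  shows "graph_length takagi {x1<..<x2} = \<infinity>"
proof (rule ccontr)
  assume "graph_length takagi {x1<..<x2} \<noteq> \<infinity>"
  then obtain r where r: "r \<ge> 0" "graph_length takagi {x1<..<x2} = ennreal r"
    by (cases "graph_length takagi {x1<..<x2}") auto
  obtain n x where nx: "2 ^ n * x \<in> \<int>" "{x..x + 1 / 2 ^ n} \<subseteq> {x1<..<x2}"
    using dyadic_interval_in_open_interval[OF assms(2)] by blast
  obtain p where p: "dyadic_variation takagi n p x \<ge> r + 1"
    using dyadic_variation_unbounded[OF nx(1)] by blast
  have "ennreal (dyadic_variation takagi n p x) \<le> ennreal r"
    using dyadic_variation_le_graph_length[OF nx(2)] r(2) by metis
  then show False using p r(1) by simp
qed

end
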